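(* Any streaming algorithm for \textsc{Diameter} on general graphs in the AL model that uses $p$ passes over the stream requires $\Omega(n^2/p)$ bits of memory on $n$-vertex graphs.
   Context: Graphs are finite, simple, undirected, unweighted. \textsc{Diameter}: compute $\max_{s,t} d(s,t)$ (shortest-path distance). In the Adjacency List (AL) streaming model the graph arrives as a sequence of vertices in arbitrary fixed order, each with the full list of its incident edges (each edge appears twice). A $p$-pass algorithm reads the sequence $p$ times with unlimited computation; memory is in bits. "Requires $\Omega(f)$ bits" means there is a constant $c>0$ such that every such algorithm uses at least $c f$ bits on some $n$-vertex input, for all sufficiently large $n$ and all $p$. *)

theory Defs
  imports "Graph_Theory.Graph_Theory" "HOL-Library.Extended_Real"
begin

text \<open>
  A finite simple undirected graph is a \<^locale>\<open>pair_graph\<close>, i.e. a finite, loop-free, symmetric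
  digraph without parallel arcs; the edge between u and v is the pair of arcs (u, v), (v, u).
  With unit weights, the library's shortest-path cost \<^const>\<open>wf_digraph.\<mu>\<close> is the hop distance;
  it is infinite if there is no path, so a disconnected graph has infinite diameter.
\<close>

definition graph_dist :: "'a pair_pre_digraph \<Rightarrow> 'a \<Rightarrow> 'a \<Rightarrow> ereal" where
  "graph_dist G s t = wf_digraph.\<mu> (with_proj G) (\<lambda>_. 1) s t"

definition graph_diameter :: "'a pair_pre_digraph \<Rightarrow> ereal" where
  "graph_diameter G = (SUP s\<in>pverts G. SUP t\<in>pverts G. graph_dist G s t)"

definition graph_on :: "nat \<Rightarrow> nat pair_pre_digraph \<Rightarrow> bool" where
  "graph_on n G \<longleftrightarrow> pair_graph G \<and> pverts G = {..<n}"

type_synonym al_item = "nat \<times> nat list"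

text \<open>
  The edges incident to a vertex are listed, in any order, by their other endpoints.
\<close>

definition al_stream :: "nat pair_pre_digraph \<Rightarrow> al_item list \<Rightarrow> bool" where
  "al_stream G S \<longleftrightarrow>
     distinct (map fst S) \<and> set (map fst S) = pverts G \<and>
     (\<forall>(v, ns) \<in> set S. distinct ns \<and> set ns = {w. (v, w) \<in> parcs G})"

text \<open>
  The memory content is a bit string of varying length. Computation is unlimited, so the
  update and output functions are arbitrary. The first two arguments of the update function are
  the number of the current pass and the position within it: the algorithm gets these without
  storing them, and it sees a vertex together with its whole list in one step. Both
  conventions only enlarge the class of algorithms to which a lower bound applies.
\<close>

record stream_alg =
  init_mem :: "bool list"
  update :: "nat \<Rightarrow> nat \<Rightarrow> bool list \<Rightarrow> al_item \<Rightarrow> bool list"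
  out :: "bool list \<Rightarrow> ereal"

text \<open>
  Memory content after t items have been read in total; the stream is repeated cyclically,
  in the same order in every pass.
\<close>

primrec mem_at :: "stream_alg \<Rightarrow> al_item list \<Rightarrow> nat \<Rightarrow> bool list" where
  "mem_at A S 0 = init_mem A"
| "mem_at A S (Suc t) =
     update A (t div length S) (t mod length S) (mem_at A S t) (S ! (t mod length S))"

definition result :: "stream_alg \<Rightarrow> nat \<Rightarrow> al_item list \<Rightarrow> ereal" where
  "result A p S = out A (mem_at A S (p * length S))"

definition memory_used :: "stream_alg \<Rightarrow> nat \<Rightarrow> al_item list \<Rightarrow> nat" where
  "memory_used A p S = Max ((\<lambda>t. length (mem_at A S t)) ` {..p * length S})"

definition solves_diameter :: "stream_alg \<Rightarrow> nat \<Rightarrow> nat \<Rightarrow> bool" where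
  "solves_diameter A p n \<longleftrightarrow>
     (\<forall>G S. graph_on n G \<longrightarrow> al_stream G S \<longrightarrow> result A p S = graph_diameter G)"

end

theory Submission
  imports Defs
begin

text \<open>
  Two players hold sets x and y of pairs below k. They jointly build a graph with about 4 k vertices
  that has diameter 2 if x is a subset of y, and larger diameter otherwise. The adjacency lists of
  one half of the vertices depend on x only and all others on y only, so a p-pass algorithm
  yields a protocol with 2 p messages. The pairs (x, x) form a fooling set: if (x, x) and (y, y)
  had the same transcript, then so would (x, y) and (y, x), which forces x = y. Hence there are at
  least 2 to the k * k transcripts, whereas messages of at most M bits allow at most
  2 to the 4 M p of them.
\<close>

section \<open>Distance and diameter at most two\<close>

lemma graph_dist_le_2_iff:
  assumes G: "pair_graph G" and s: "s \<in> pverts G"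
  shows "graph_dist G s t \<le> 2 \<longleftrightarrow>
    s = t \<or> (s, t) \<in> parcs G \<or> (\<exists>w. (s, w) \<in> parcs G \<and> (w, t) \<in> parcs G)"
    (is "_ \<longleftrightarrow> ?near")
proof -
  interpret pair_graph G by (fact G)
  have cost: "awalk_cost (\<lambda>_. 1) p = real (length p)" for p
    by (induction p) auto
  show ?thesis
  proof
    assume near: ?near
    have "\<exists>p. awalk s p t \<and> length p \<le> 2"
    proof -
      consider "s = t" | "(s, t) \<in> parcs G"
        | w where "(s, w) \<in> parcs G" "(w, t) \<in> parcs G"
        using near by blast
      then show ?thesis
      proof cases
        case 1
        then show ?thesis using s by (intro exI[of _ "[]"]) (simp add: awalk_Nil_iff)
      next
        case 2
        then show ?thesis
          by (intro exI[of _ "[(s, t)]"]) (auto simp: awalk_simps dest: in_arcsD2)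
      next
        case 3
        then show ?thesis
          by (intro exI[of _ "[(s, w), (w, t)]"]) (auto simp: awalk_simps dest: in_arcsD2)
      qed
    qed
    then obtain p where "awalk s p t" and p: "length p \<le> 2" by blast
    then have "graph_dist G s t \<le> ereal (real (length p))"
      using min_cost_le_walk_cost[of s p t "\<lambda>_. 1"] by (simp add: graph_dist_def cost)
    also have "\<dots> \<le> 2"
      using p by simp
    finally show "graph_dist G s t \<le> 2" .
  next
    assume le: "graph_dist G s t \<le> 2"
    show ?near
    proof (rule ccontr)
      assume far: "\<not> ?near"
      \<comment> \<open>A uniform lower bound on walk lengths carries over to the infimum
        \<open>\<mu>\<close>, so no shortest walk has to be exhibited; the case of no walk at all,
        with infinite distance, is covered as well.\<close>
      have "3 \<le> length p" if "awalk s p t" for p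
      proof (rule ccontr)
        assume "\<not> 3 \<le> length p"
        then have "length p = 0 \<or> length p = 1 \<or> length p = 2" by linarith
        then show False
          using that far
          by (auto simp: length_Suc_conv awalk_simps numeral_2_eq_2)
      qed
      then have "3 \<le> graph_dist G s t"
        unfolding graph_dist_def \<mu>_def by (intro INF_greatest) (auto simp: cost)
      then have "(3::ereal) \<le> 2" using le by (rule order_trans)
      then show False by simp
    qed
  qed
qed

lemma graph_diameter_le_iff:
  "graph_diameter G \<le> d \<longleftrightarrow> (\<forall>s\<in>pverts G. \<forall>t\<in>pverts G. graph_dist G s t \<le> d)"
  by (simp add: graph_diameter_def SUP_le_iff)

section \<open>The gadget graph and set inclusion\<close>

text \<open>
  For i < k the vertices i, k + i, 2 k + i, 3 k + i are called a(i), a'(i), b(i), b'(i). The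
  paths of length 2 from a(i) to b'(j) lead through a'(j), if (i, j) is not in x, or through b(i),
  if (i, j) is in y. The vertices 4 k, ..., 4 k + 3 are hubs, adjacent to all a, a', to all b, b',
  to all a, b and to all a', b' respectively; they bring all other pairs (except a'(j), b(i),
  which behave like a(i), b'(j)) within distance 2. Vertices from 4 k + 4 on are padding,
  adjacent to every hub.
\<close>

definition half_adj :: "nat \<Rightarrow> (nat \<times> nat) set \<Rightarrow> (nat \<times> nat) set \<Rightarrow> nat \<Rightarrow> nat \<Rightarrow> bool" where
  "half_adj k x y u v \<longleftrightarrow>
     u < k \<and> k \<le> v \<and> v < 2 * k \<and> (u, v - k) \<notin> x \<or>
     2 * k \<le> u \<and> u < 3 * k \<and> 3 * k \<le> v \<and> v < 4 * k \<and> (u - 2 * k, v - 3 * k) \<in> y \<or>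
     u < 2 * k \<and> v = u + 2 * k \<or>
     u < 2 * k \<and> v = 4 * k \<or>
     2 * k \<le> u \<and> u < 4 * k \<and> v = 4 * k + 1 \<or>
     (u < k \<or> 2 * k \<le> u \<and> u < 3 * k) \<and> v = 4 * k + 2 \<or>
     (k \<le> u \<and> u < 2 * k \<or> 3 * k \<le> u \<and> u < 4 * k) \<and> v = 4 * k + 3 \<or>
     4 * k \<le> u \<and> u < 4 * k + 4 \<and> u < v"

definition gadget :: "nat \<Rightarrow> nat \<Rightarrow> (nat \<times> nat) set \<Rightarrow> (nat \<times> nat) set \<Rightarrow> nat pair_pre_digraph" where
  "gadget n k x y = \<lparr> pverts = {..<n},
     parcs = {(u, v). u < n \<and> v < n \<and> (half_adj k x y u v \<or> half_adj k x y v u)} \<rparr>"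

lemma pverts_gadget [simp]: "pverts (gadget n k x y) = {..<n}"
  by (simp add: gadget_def)

lemma parcs_gadget [simp]:
  "(u, v) \<in> parcs (gadget n k x y) \<longleftrightarrow>
    u < n \<and> v < n \<and> (half_adj k x y u v \<or> half_adj k x y v u)"
  by (simp add: gadget_def)

text \<open>\<open>half_adj\<close> lists every edge from its smaller to its larger endpoint; hence
  symmetrising it in \<open>gadget\<close> creates no loops.\<close>

lemma half_adj_less: "half_adj k x y u v \<Longrightarrow> u < v"
  by (auto simp: half_adj_def)

lemma graph_on_gadget: "graph_on n (gadget n k x y)"
proof -
  have sub: "parcs (gadget n k x y) \<subseteq> {..<n} \<times> {..<n}"
    by (auto simp: gadget_def)
  have "finite (parcs (gadget n k x y))"
    by (rule finite_subset[OF sub]) simp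
  moreover have "symmetric (with_proj (gadget n k x y))"
    by (auto simp: symmetric_def sym_def)
  ultimately have "pair_graph (gadget n k x y)"
    using sub by unfold_locales (auto dest: half_adj_less)
  then show ?thesis by (simp add: graph_on_def)
qed

text \<open>Most pairs are joined through a common hub. For the pairs that have none, inclusion on
  the k by k square guarantees one of two routes: (i, j) is outside \<open>x\<close> or inside
  \<open>y\<close>.\<close>

lemma gadget_near:
  assumes n: "4 * k + 4 \<le> n" and uv: "u < v" "v < n"
    and sub: "\<And>i j. i < k \<Longrightarrow> j < k \<Longrightarrow> (i, j) \<in> x \<Longrightarrow> (i, j) \<in> y"
  shows "(u, v) \<in> parcs (gadget n k x y) \<or>
    (\<exists>w. (u, w) \<in> parcs (gadget n k x y) \<and> (w, v) \<in> parcs (gadget n k x y))"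
proof -
  let ?E = "parcs (gadget n k x y)"
  have via: ?thesis if "(u, w) \<in> ?E" "w = v \<or> (w, v) \<in> ?E" for w
    using that by blast
  have sym: "(w, u) \<in> ?E" if "(u, w) \<in> ?E" for u w
    using that by auto
  \<comment> \<open>The two hubs adjacent to a vertex below 4 k: \<open>side\<close> separates a, a'
    from b, b', and \<open>part\<close> separates a, b from a', b'.\<close>
  define side where "side u = (if u < 2 * k then 4 * k else 4 * k + 1)" for u
  define part where
    "part u = (if u < k \<or> 2 * k \<le> u \<and> u < 3 * k then 4 * k + 2 else 4 * k + 3)" for u
  have side: "(u, side u) \<in> ?E" if "u < 4 * k" for u
    using that n by (simp add: half_adj_def side_def)
  have part: "(u, part u) \<in> ?E" if "u < 4 * k" for u
    using that n by (simp add: half_adj_def part_def) linarith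
  have side_hub: "4 * k \<le> side u" "side u < 4 * k + 4" for u
    by (simp_all add: side_def)
  have hub: "(h, w) \<in> ?E" if "4 * k \<le> h" "h < 4 * k + 4" "4 * k \<le> w" "w < n" "w \<noteq> h" for h w
    using that n by (cases "h < w") (simp_all add: half_adj_def)
  have cross: "(w, w + 2 * k) \<in> ?E" if "w < 2 * k" for w
    using that n by (simp add: half_adj_def)
  have left: "(i, k + j) \<in> ?E" if "i < k" "j < k" "(i, j) \<notin> x" for i j
    using that n by (simp add: half_adj_def)
  have right: "(2 * k + i, 3 * k + j) \<in> ?E" if "i < k" "j < k" "(i, j) \<in> y" for i j
    using that n by (simp add: half_adj_def)
  \<comment> \<open>In order: both padding; u a hub; only v a hub or padding; both on the left side;
    both on the right side; a with b; a' with b'; a with b'; a' with b. Only the last two depend on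
    \<open>x\<close> and \<open>y\<close>.\<close>
  consider "4 * k + 4 \<le> u" | "4 * k \<le> u" "u < 4 * k + 4" | "u < 4 * k" "4 * k \<le> v"
    | "v < 2 * k" | "2 * k \<le> u" "v < 4 * k"
    | "u < k" "2 * k \<le> v" "v < 3 * k"
    | "k \<le> u" "u < 2 * k" "3 * k \<le> v" "v < 4 * k"
    | "u < k" "3 * k \<le> v" "v < 4 * k"
    | "k \<le> u" "u < 2 * k" "2 * k \<le> v" "v < 3 * k"
    using uv by linarith
  then show ?thesis
  proof cases
    case 1
    then show ?thesis
      using n uv by (intro via[of "4 * k"] disjI2 sym[OF hub] hub) auto
  next
    case 2
    then show ?thesis using uv hub by auto
  next
    case 3
    then show ?thesis
      using uv side_hub[of u] by (intro via[of "side u"] side) (auto intro!: hub simp del: parcs_gadget)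
  next
    case 4
    then have "side u = side v" "u < 4 * k" "v < 4 * k"
      using uv by (simp_all add: side_def)
    then show ?thesis
      using side[of u] sym[OF side[of v]] by (intro via[of "side u"]) (simp_all del: parcs_gadget)
  next
    case 5
    then have "side u = side v" "u < 4 * k" "v < 4 * k"
      using uv by (simp_all add: side_def)
    then show ?thesis
      using side[of u] sym[OF side[of v]] by (intro via[of "side u"]) (simp_all del: parcs_gadget)
  next
    case 6
    then have "part u = part v" "u < 4 * k" "v < 4 * k"
      using uv by (simp_all add: part_def)
    then show ?thesis
      using part[of u] sym[OF part[of v]] by (intro via[of "part u"]) (simp_all del: parcs_gadget)
  next
    case 7
    then have "part u = part v" "u < 4 * k" "v < 4 * k"
      using uv by (simp_all add: part_def)
    then show ?thesis
      using part[of u] sym[OF part[of v]] by (intro via[of "part u"]) (simp_all del: parcs_gadget)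
  next
    case 8
    define j where "j = v - 3 * k"
    then have j: "v = 3 * k + j" "j < k"
      using 8 by auto
    show ?thesis
    \<comment> \<open>The middle vertex is b(u) if (u, j) is in \<open>x\<close>, hence in
      \<open>y\<close>, and a'(j) otherwise.\<close>
    proof (cases "(u, j) \<in> x")
      case True
      have "(u, u + 2 * k) \<in> ?E"
        using cross 8 by simp
      moreover have "(u + 2 * k, v) \<in> ?E"
        using right[of u j] sub[OF _ _ True] 8 j by (simp add: algebra_simps del: parcs_gadget)
      ultimately show ?thesis by (rule via[OF _ disjI2])
    next
      case False
      have "(u, k + j) \<in> ?E"
        using left[of u j] False 8 j by (simp del: parcs_gadget)
      moreover have "(k + j, v) \<in> ?E"
        using cross[of "k + j"] j by (simp add: algebra_simps del: parcs_gadget)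
      ultimately show ?thesis by (rule via[OF _ disjI2])
    qed
  next
    case 9
    \<comment> \<open>Here u is a'(j) and v is b(i); the middle vertex is b'(j) or a(i).\<close>
    define i j where "i = v - 2 * k" and "j = u - k"
    then have ij: "v = i + 2 * k" "u = k + j" "i < k" "j < k"
      using 9 by auto
    show ?thesis
    proof (cases "(i, j) \<in> x")
      case True
      have "(u, u + 2 * k) \<in> ?E"
        using cross 9 by simp
      moreover have "(u + 2 * k, v) \<in> ?E"
        using sym[OF right[of i j]] sub[OF _ _ True] ij by (simp add: algebra_simps del: parcs_gadget)
      ultimately show ?thesis by (rule via[OF _ disjI2])
    next
      case False
      have "(u, i) \<in> ?E"
        using sym[OF left[of i j]] False ij by (simp del: parcs_gadget)
      moreover have "(i, v) \<in> ?E"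
        using cross[of i] ij by simp
      ultimately show ?thesis by (rule via[OF _ disjI2])
    qed
  qed
qed

text \<open>The neighbours of a(i) are b(i), two hubs and the a'(j') with (i, j') outside
  \<open>x\<close>. Those of b'(j) are a'(j), the other two hubs and the b(i') with (i', j) in
  \<open>y\<close>. A pair (i, j) in \<open>x\<close> but not in \<open>y\<close> makes these sets
  disjoint.\<close>

lemma gadget_far:
  assumes "i < k" "j < k" "(i, j) \<in> x" "(i, j) \<notin> y"
  shows "(i, 3 * k + j) \<notin> parcs (gadget n k x y)"
    and "(i, w) \<in> parcs (gadget n k x y) \<Longrightarrow> (w, 3 * k + j) \<notin> parcs (gadget n k x y)"
proof -
  show "(i, 3 * k + j) \<notin> parcs (gadget n k x y)"
    using assms by (auto simp: half_adj_def)
  assume "(i, w) \<in> parcs (gadget n k x y)"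
  moreover have "\<not> half_adj k x y w i"
    using assms(1) by (auto simp: half_adj_def)
  ultimately have "half_adj k x y i w"
    by simp
  then consider j' where "w = k + j'" "j' < k" "(i, j') \<notin> x"
    | "w = i + 2 * k" | "w = 4 * k" | "w = 4 * k + 2"
    using assms(1) by (auto simp: half_adj_def dest!: le_Suc_ex)
  then show "(w, 3 * k + j) \<notin> parcs (gadget n k x y)"
    by cases (use assms in \<open>auto simp: half_adj_def\<close>)
qed

text \<open>The bound on \<open>x\<close> matters because pairs outside the square leave no trace in
  the graph.\<close>

lemma gadget_diameter_le_2_iff:
  assumes n: "4 * k + 4 \<le> n" and x: "x \<subseteq> {..<k} \<times> {..<k}"
  shows "graph_diameter (gadget n k x y) \<le> 2 \<longleftrightarrow> x \<subseteq> y"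
proof -
  let ?G = "gadget n k x y"
  have G: "pair_graph ?G"
    using graph_on_gadget by (simp add: graph_on_def)
  let ?near = "\<lambda>u v. (u, v) \<in> parcs ?G \<or> (\<exists>w. (u, w) \<in> parcs ?G \<and> (w, v) \<in> parcs ?G)"
  have sym: "?near u v" if "?near v u" for u v
    using that by auto
  have "graph_diameter ?G \<le> 2 \<longleftrightarrow> (\<forall>s<n. \<forall>t<n. s = t \<or> ?near s t)"
    using graph_dist_le_2_iff[OF G] by (simp add: graph_diameter_le_iff Ball_def)
  also have "\<dots> \<longleftrightarrow> x \<subseteq> y"
  proof
    assume near: "\<forall>s<n. \<forall>t<n. s = t \<or> ?near s t"
    show "x \<subseteq> y"
    proof (rule subrelI, rule ccontr)
      fix i j assume ij: "(i, j) \<in> x" "(i, j) \<notin> y"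
      then have "i < k" "j < k" using x by auto
      moreover from this have "?near i (3 * k + j)"
        using near[rule_format, of i "3 * k + j"] n by auto
      ultimately show False
        using gadget_far(1)[of i k j x y n] gadget_far(2)[of i k j x y _ n] ij by blast
    qed
  next
    assume sub: "x \<subseteq> y"
    show "\<forall>s<n. \<forall>t<n. s = t \<or> ?near s t"
    proof (intro allI impI)
      fix s t assume st: "s < n" "t < n"
      consider "s = t" | "s < t" | "t < s" by linarith
      then show "s = t \<or> ?near s t"
      proof cases
        case 2
        then show ?thesis using gadget_near[OF n 2 st(2), of x y] sub by blast
      next
        case 3
        then have "?near t s" using gadget_near[OF n 3 st(1), of x y] sub by blast
        then show ?thesis using sym by blast
      qed simp
    qed
  qed
  finally show ?thesis .
qed

section \<open>Adjacency list streams of gadgets\<close>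

text \<open>Sorting puts vertex v of a gadget at position v and makes its item a function of its
  neighbourhood alone, so equal neighbourhoods give equal items.\<close>

definition adj_list_stream :: "nat pair_pre_digraph \<Rightarrow> al_item list" where
  "adj_list_stream G =
     map (\<lambda>v. (v, sorted_list_of_set {w. (v, w) \<in> parcs G})) (sorted_list_of_set (pverts G))"

lemma al_stream_adj_list_stream:
  assumes "graph_on n G"
  shows "al_stream G (adj_list_stream G)"
proof -
  interpret pair_graph G using assms by (simp add: graph_on_def)
  have "finite {w. (v, w) \<in> parcs G}" for v
    by (rule finite_subset[OF _ pair_finite_verts]) (auto dest: in_arcsD2)
  then show ?thesis
    using pair_finite_verts by (auto simp: al_stream_def adj_list_stream_def o_def)
qed

abbreviation gadget_stream :: "nat \<Rightarrow> nat \<Rightarrow> (nat \<times> nat) set \<Rightarrow> (nat \<times> nat) set \<Rightarrow> al_item list" where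
  "gadget_stream n k x y \<equiv> adj_list_stream (gadget n k x y)"

lemma length_gadget_stream [simp]: "length (gadget_stream n k x y) = n"
  by (simp add: adj_list_stream_def)

lemma nth_gadget_stream:
  "v < n \<Longrightarrow> gadget_stream n k x y ! v = (v, sorted_list_of_set {w. (v, w) \<in> parcs (gadget n k x y)})"
  by (simp add: adj_list_stream_def lessThan_atLeast0)

text \<open>Edges controlled by \<open>y\<close> run only between b and b', so the items before
  position 2 k, those of a and a', do not see \<open>y\<close>.\<close>

lemma nth_gadget_stream_left:
  assumes "v < n" "v < 2 * k"
  shows "gadget_stream n k x y ! v = gadget_stream n k x y' ! v"
proof -
  have "half_adj k x y v w = half_adj k x y' v w" "half_adj k x y w v = half_adj k x y' w v" for w
    using assms by (auto simp: half_adj_def)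
  then show ?thesis using assms by (simp add: nth_gadget_stream)
qed

lemma nth_gadget_stream_right:
  assumes "v < n" "2 * k \<le> v"
  shows "gadget_stream n k x y ! v = gadget_stream n k x' y ! v"
proof -
  have "half_adj k x y v w = half_adj k x' y v w" "half_adj k x y w v = half_adj k x' y w v" for w
    using assms by (auto simp: half_adj_def)
  then show ?thesis using assms by (simp add: nth_gadget_stream)
qed

section \<open>Transcripts and cut and paste\<close>

text \<open>The messages are the memory contents at the two handovers of each pass, after its first
  m items and at its end.\<close>

definition transcript :: "stream_alg \<Rightarrow> nat \<Rightarrow> nat \<Rightarrow> al_item list \<Rightarrow> (bool list \<times> bool list) list" where
  "transcript A p m S =
     map (\<lambda>j. (mem_at A S (j * length S + m), mem_at A S (Suc j * length S))) [0..<p]"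

text \<open>Cut and paste for the two-party protocol in which one player holds the first m items of
  the stream and the other one the rest.\<close>

lemma result_crossover:
  assumes len: "length S = n" "length S' = n" "length T = n" and m: "0 < m" "m < n"
    and left: "\<And>r. r < m \<Longrightarrow> T ! r = S ! r"
    and right: "\<And>r. m \<le> r \<Longrightarrow> r < n \<Longrightarrow> T ! r = S' ! r"
    and tr: "transcript A p m S = transcript A p m S'"
  shows "result A p T = result A p S"
proof -
  have nth: "(mem_at A S (j * n + m), mem_at A S (Suc j * n)) =
      (mem_at A S' (j * n + m), mem_at A S' (Suc j * n))" if "j < p" for j
    using tr that unfolding transcript_def map_eq_conv by (simp add: len)
  \<comment> \<open>The two runs agree at every handover. Time 0 is missing from the transcript, but
    there both runs hold \<open>init_mem\<close>.\<close>
  have cut: "mem_at A S t = mem_at A S' t" if "t \<le> p * n" "t mod n = 0 \<or> t mod n = m" for t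
  proof -
    have t: "t = t div n * n + t mod n" by simp
    show ?thesis
    proof (cases "t mod n = m")
      case True
      have "t div n < p"
      proof (rule ccontr)
        assume "\<not> t div n < p"
        then have "p * n \<le> t div n * n"
          by (intro mult_le_mono1) simp
        then show False using that(1) m t True by linarith
      qed
      then show ?thesis using nth[of "t div n"] t True by simp
    next
      case False
      then have mod: "t mod n = 0" using that(2) by simp
      show ?thesis
      proof (cases "t div n")
        case 0
        then show ?thesis using t mod by simp
      next
        case (Suc j)
        then have "t = Suc j * n" using t mod by simp
        moreover from this have "Suc j \<le> p" using that(1) m by (simp only: mult_le_cancel2)
        ultimately show ?thesis using nth[of j] by simp
      qed
    qed
  qed
  \<comment> \<open>The run on \<open>T\<close> follows \<open>S\<close> in the first segment of
    each pass and \<open>S'\<close> in the second. Both claims hold at the handovers, residues 0 and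
    m, where \<open>cut\<close> permits the switch; the final time has residue 0.\<close>
  have "(t mod n \<le> m \<longrightarrow> mem_at A T t = mem_at A S t) \<and>
        (t mod n = 0 \<or> m \<le> t mod n \<longrightarrow> mem_at A T t = mem_at A S' t)" if "t \<le> p * n" for t
    using that
  proof (induction t)
    case 0
    then show ?case by simp
  next
    case (Suc t)
    let ?r = "t mod n"
    have r: "?r < n" using m by simp
    have suc: "Suc t mod n = (if Suc ?r = n then 0 else Suc ?r)"
      by (simp add: mod_Suc)
    show ?case
    proof (cases "?r < m")
      case True
      then have "mem_at A T (Suc t) = mem_at A S (Suc t)"
        using Suc left[of ?r] by (simp add: len)
      then show ?thesis
        using True m suc cut[OF Suc.prems] by auto
    next
      case False
      then have "mem_at A T (Suc t) = mem_at A S' (Suc t)"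
        using Suc right[of ?r] r by (simp add: len)
      then show ?thesis
        using False m suc cut[OF Suc.prems] by auto
    qed
  qed
  from this[of "p * n"] show ?thesis
    by (simp add: result_def len)
qed

section \<open>Counting transcripts\<close>

text \<open>The sum of powers of 2 is relaxed to \<open>4 ^ M\<close> to keep the exponent a pure
  multiple of \<open>M\<close>, with no additive term even for M = 0.\<close>

lemma card_bool_lists_le: "card {w :: bool list. length w \<le> M} \<le> 4 ^ M"
proof -
  have "card {w :: bool list. length w \<le> M} = (\<Sum>i\<le>M. 2 ^ i)"
    using card_lists_length_le[of "UNIV :: bool set" M] by simp
  also have "\<dots> \<le> 4 ^ M"
  proof (induction M)
    case (Suc M)
    have "(2::nat) ^ Suc M \<le> 2 * 4 ^ M" by (simp add: power_mono)
    then show ?case using Suc by simp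
  qed simp
  finally show ?thesis .
qed

text \<open>Each pass contributes two messages with at most \<open>4 ^ M\<close> values each, hence
  a factor \<open>2 ^ (4 * M)\<close>.\<close>

lemma card_transcripts_le:
  defines "B M \<equiv> {w :: bool list. length w \<le> M}"
  shows "finite {ws. set ws \<subseteq> B M \<times> B M \<and> length ws = p}"
    and "card {ws. set ws \<subseteq> B M \<times> B M \<and> length ws = p} \<le> 2 ^ (4 * M * p)"
proof -
  have fin: "finite (B M \<times> B M)"
    using finite_lists_length_le[of "UNIV :: bool set" M] by (simp add: B_def)
  then show "finite {ws. set ws \<subseteq> B M \<times> B M \<and> length ws = p}"
    by (rule finite_lists_length_eq)
  have "card {ws. set ws \<subseteq> B M \<times> B M \<and> length ws = p} = (card (B M) * card (B M)) ^ p"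
    using card_lists_length_eq[OF fin] by (simp add: card_cartesian_product)
  also have "\<dots> \<le> (4 ^ M * 4 ^ M) ^ p"
    unfolding B_def by (intro power_mono mult_mono card_bool_lists_le) auto
  also have "\<dots> = ((2 ^ 2) ^ (2 * M * p) :: nat)"
    by (simp add: power_add [symmetric] power_mult [symmetric] mult_2)
  also have "\<dots> = 2 ^ (4 * M * p)"
    by (simp only: power_mult [symmetric]) (simp add: ac_simps)
  finally show "card {ws. set ws \<subseteq> B M \<times> B M \<and> length ws = p} \<le> 2 ^ (4 * M * p)" .
qed

lemma length_mem_at_le:
  "t \<le> p * length S \<Longrightarrow> length (mem_at A S t) \<le> memory_used A p S"
  by (auto simp: memory_used_def)

lemma transcript_in:
  assumes "memory_used A p S \<le> M" "m \<le> length S"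
  defines "B \<equiv> {w :: bool list. length w \<le> M}"
  shows "transcript A p m S \<in> {ws. set ws \<subseteq> B \<times> B \<and> length ws = p}"
proof -
  have "length (mem_at A S t) \<le> M" if "t \<le> p * length S" for t
    using length_mem_at_le[OF that, of A] assms(1) by linarith
  moreover have "j * length S + m \<le> p * length S" "Suc j * length S \<le> p * length S" if "j < p" for j
  proof -
    have "Suc j * length S \<le> p * length S"
      using that by (intro mult_le_mono1) simp
    then show "j * length S + m \<le> p * length S" "Suc j * length S \<le> p * length S"
      using assms(2) by simp_all
  qed
  ultimately show ?thesis
    by (auto simp: transcript_def B_def simp del: mult_Suc)
qed

section \<open>Fooling set and memory bound\<close>

lemma transcript_inj:
  assumes A: "solves_diameter A p n" and n: "4 * k + 4 \<le> n" and k: "0 < k"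
  shows "inj_on (\<lambda>x. transcript A p (2 * k) (gadget_stream n k x x)) (Pow ({..<k} \<times> {..<k}))"
proof -
  have res: "result A p (gadget_stream n k x y) = graph_diameter (gadget n k x y)" for x y
    using A graph_on_gadget[of n k x y] al_stream_adj_list_stream[OF graph_on_gadget, of n k x y]
    by (auto simp: solves_diameter_def)
  have "x \<subseteq> y"
    if x: "x \<in> Pow ({..<k} \<times> {..<k})"
      and tr: "transcript A p (2 * k) (gadget_stream n k x x) =
        transcript A p (2 * k) (gadget_stream n k y y)" for x y
  proof -
    \<comment> \<open>The stream of (x, y) agrees with that of (x, x) before position 2 k and with
      that of (y, y) from there on.\<close>
    have "result A p (gadget_stream n k x y) = result A p (gadget_stream n k x x)"
      using n k
      by (intro result_crossover[OF _ _ _ _ _ _ _ tr])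
        (auto intro: nth_gadget_stream_left nth_gadget_stream_right)
    moreover have "graph_diameter (gadget n k x x) \<le> 2"
      using gadget_diameter_le_2_iff[OF n, of x x] x by simp
    ultimately have "graph_diameter (gadget n k x y) \<le> 2"
      by (simp add: res)
    then show ?thesis
      using gadget_diameter_le_2_iff[OF n, of x y] x by simp
  qed
  then show ?thesis
    by (intro inj_onI subset_antisym) auto
qed

lemma memory_lower_bound:
  assumes A: "solves_diameter A p n" and n: "4 * k + 4 \<le> n" and k: "0 < k"
  obtains x where "k\<^sup>2 \<le> 4 * memory_used A p (gadget_stream n k x x) * p"
proof -
  let ?X = "Pow ({..<k} \<times> {..<k})"
  let ?used = "\<lambda>x. memory_used A p (gadget_stream n k x x)"
  let ?tr = "\<lambda>x. transcript A p (2 * k) (gadget_stream n k x x)"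
  \<comment> \<open>\<open>M\<close> is the worst case over the fooling inputs. It is attained, so a
    bound on \<open>M\<close> is a bound for one concrete input.\<close>
  define M where "M = Max (?used ` ?X)"
  define B where "B = {w :: bool list. length w \<le> M}"
  have M: "?used x \<le> M" if "x \<in> ?X" for x
    using that unfolding M_def by (intro Max_ge) auto
  have "M \<in> ?used ` ?X"
    unfolding M_def by (intro Max_in) auto
  then obtain x where x: "M = ?used x" by blast
  have "?tr ` ?X \<subseteq> {ws. set ws \<subseteq> B \<times> B \<and> length ws = p}"
    using transcript_in[OF M, of _ "2 * k"] n by (auto simp: B_def)
  then have "card ?X \<le> card {ws. set ws \<subseteq> B \<times> B \<and> length ws = p}"
    using card_inj_on_le[OF transcript_inj[OF assms]] card_transcripts_le(1)
    by (simp add: B_def)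
  also have "\<dots> \<le> 2 ^ (4 * M * p)"
    unfolding B_def by (rule card_transcripts_le(2))
  finally have "(2::nat) ^ (k * k) \<le> 2 ^ (4 * M * p)"
    by (simp add: card_Pow)
  then have "k * k \<le> 4 * M * p" by simp
  then show ?thesis
    using that[of x] by (simp only: x power2_eq_square)
qed

theorem theorem26:
  shows "\<exists>c::real. c > 0 \<and> (\<exists>N::nat. \<forall>n\<ge>N. \<forall>p\<ge>1. \<forall>A::stream_alg.
    solves_diameter A p n \<longrightarrow>
    (\<exists>G S. graph_on n G \<and> al_stream G S \<and>
       real (memory_used A p S) \<ge> c * (real n)\<^sup>2 / real p))"
proof (intro exI[of _ "1/256 :: real"] conjI exI[of _ "14 :: nat"] allI impI)
  fix n p :: nat and A
  assume n: "14 \<le> n" and p: "1 \<le> p" and A: "solves_diameter A p n"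
  \<comment> \<open>The largest \<open>k\<close> whose gadget fits into n vertices. For n at least
    14 it is positive and satisfies n \<le> 8 k; squaring costs 64, and the factor 4 of
    \<open>memory_lower_bound\<close> makes this 256.\<close>
  define k where "k = n div 4 - 1"
  have k: "4 * k + 4 \<le> n" "0 < k" and nk: "n \<le> 8 * k"
    using n unfolding k_def by presburger+
  obtain x where x: "k\<^sup>2 \<le> 4 * memory_used A p (gadget_stream n k x x) * p"
    using memory_lower_bound[OF A k] .
  have "n\<^sup>2 \<le> (8 * k)\<^sup>2"
    using nk by (rule power_mono) simp
  also have "\<dots> \<le> 256 * memory_used A p (gadget_stream n k x x) * p"
    using x by (simp add: power_mult_distrib ac_simps)
  finally have "real (n\<^sup>2) \<le> real (256 * memory_used A p (gadget_stream n k x x) * p)"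
    by (rule of_nat_mono)
  then have "1 / 256 * (real n)\<^sup>2 / real p \<le> real (memory_used A p (gadget_stream n k x x))"
    using p by (simp add: field_simps)
  then show "\<exists>G S. graph_on n G \<and> al_stream G S \<and>
      1 / 256 * (real n)\<^sup>2 / real p \<le> real (memory_used A p S)"
    using graph_on_gadget al_stream_adj_list_stream by blast
qed simp

end
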